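(* Let $X=\mathbb P^2$, $G=SL_3$. There exists a nonempty Zariski open subset $U_0\subset V^\vee$ such that for each $\delta\in U_0$ one has $\mathcal N(\delta)\ne\emptyset$, where a vector $(\lambda_I)\in V^\vee$ is identified with the first order constant coefficient operator $\delta=\sum_I\lambda_I\partial_I$.
   Context: $V^\vee=\Gamma(\mathbb P^2,\mathcal O(3))\cong\mathbb C^{10}$ is the space of ternary cubic forms in $x_1,x_2,x_3$, with linear coordinates $a_I$, $I=(ijk)$, $i+j+k=3$, proportional to the coefficients of the monomials $x^I=x_1^ix_2^jx_3^k$ (the result does not depend on rescaling the individual $a_I$), and $\partial_I=\partial/\partial a_I$. $B\subset V^\vee$ is the set of cubics defining a smooth plane curve. The tautological system $\tau$ on $V^\vee$ for $X=\mathbb P^2$, $G=SL_3$: let $c_I$ be the coordinates on $V^\vee$ given by the coefficients of the monomials $x^I$. The solution sheaf $\mathrm{sol}(\tau)$ consists of holomorphic functions $s$ on $V^\vee$ such that $P\big((\partial/\partial c_I)_I\big)s=0$ for every polynomial $P$ in 10 variables with $P\big((x^I)_I\big)=0$ in $\mathbb C[x_1,x_2,x_3]$; $s$ is annihilated by the vector fields of the natural $\mathfrak{sl}_3$-action on $V^\vee$; and $(\sum_Ic_I\frac{\partial}{\partial c_I}+1)s=0$. For a differential operator $\delta$, $\mathcal N(\delta)=\{b\in B\mid\delta s(b)=0\ \ \forall s\in\mathrm{sol}(\tau)_b\}$. *)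

theory Defs
  imports "HOL-Analysis.Analysis" "HOL-Library.Poly_Mapping"
begin

type_synonym 'v cpoly = "('v \<Rightarrow>\<^sub>0 nat) \<Rightarrow>\<^sub>0 complex"

text \<open>The value \<open>P((f v)\<^sub>v)\<close> in a ring \<open>'a\<close>, where \<open>h\<close> is the structure map
  from the complex numbers to \<open>'a\<close>.\<close>

definition poly_subst ::
    "(complex \<Rightarrow> 'a::comm_ring_1) \<Rightarrow> ('v::finite \<Rightarrow> 'a) \<Rightarrow> 'v cpoly \<Rightarrow> 'a" where
  "poly_subst h f P =
     (\<Sum>m\<in>Poly_Mapping.keys P.
        h (Poly_Mapping.lookup P m) * (\<Prod>v\<in>UNIV. f v ^ Poly_Mapping.lookup m v))"

definition zariski_open :: "(complex ^ 'v::finite) set \<Rightarrow> bool" where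
  "zariski_open U \<longleftrightarrow>
     (\<exists>S :: 'v cpoly set. U = {a. \<exists>P\<in>S. poly_subst (\<lambda>c. c) (\<lambda>v. a $ v) P \<noteq> 0})"

definition holomorphic_vec_on ::
    "(complex ^ 'n::finite \<Rightarrow> complex) \<Rightarrow> (complex ^ 'n) set \<Rightarrow> bool" where
  "holomorphic_vec_on f W \<longleftrightarrow>
     (\<forall>x\<in>W. \<exists>f'. (f has_derivative f') (at x) \<and> (\<forall>c v. f' (c *s v) = c * f' v))"

definition cpartial ::
    "'n::finite \<Rightarrow> (complex ^ 'n \<Rightarrow> complex) \<Rightarrow> complex ^ 'n \<Rightarrow> complex" where
  "cpartial i f x = deriv (\<lambda>t. f (x + t *s axis i 1)) 0"

text \<open>The operator obtained from a polynomial by substituting the partial derivatives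
  for the variables. The partial derivatives are composed along an arbitrary enumeration of the
  index type; on holomorphic functions, the only ones it is used for, they commute, so the choice
  is immaterial.\<close>

definition index_enum :: "'n::finite list" where
  "index_enum = (SOME xs. distinct xs \<and> set xs = UNIV)"

definition monomial_op ::
    "('n::finite \<Rightarrow>\<^sub>0 nat) \<Rightarrow> (complex ^ 'n \<Rightarrow> complex) \<Rightarrow> complex ^ 'n \<Rightarrow> complex" where
  "monomial_op m = foldr (\<lambda>i D. (cpartial i ^^ Poly_Mapping.lookup m i) \<circ> D) index_enum id"

definition poly_op ::
    "'n::finite cpoly \<Rightarrow> (complex ^ 'n \<Rightarrow> complex) \<Rightarrow> complex ^ 'n \<Rightarrow> complex" where
  "poly_op P f x =
     (\<Sum>m\<in>Poly_Mapping.keys P. Poly_Mapping.lookup P m * monomial_op m f x)"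

typedef cubic_index = "{I :: 3 \<Rightarrow> nat. (\<Sum>p\<in>UNIV. I p) = 3}"
  morphisms expo Abs_cubic_index
proof
  show "(\<lambda>_. 1) \<in> {I :: 3 \<Rightarrow> nat. (\<Sum>p\<in>UNIV. I p) = 3}" by simp
qed

instance cubic_index :: finite
proof
  have "expo I p \<le> 3" for I :: cubic_index and p
    using expo[of I] member_le_sum[of p UNIV "expo I"] by simp
  then have "range expo \<subseteq> PiE (UNIV :: 3 set) (\<lambda>_. {..3})"
    by auto
  moreover have "finite (PiE (UNIV :: 3 set) (\<lambda>_. {..3::nat}))"
    by (intro finite_PiE) auto
  ultimately have "finite (range expo)"
    by (rule finite_subset)
  then show "finite (UNIV :: cubic_index set)"
    by (rule finite_imageD) (simp add: inj_on_def expo_inject)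
qed

text \<open>A ternary cubic form is represented by the vector of its coefficients \<open>c\<^sub>I\<close>.\<close>

type_synonym cubic = "complex ^ cubic_index"

text \<open>The monomial \<open>x\<^sup>I\<close>, for elements \<open>x\<^sub>1, x\<^sub>2, x\<^sub>3\<close> of any commutative ring.\<close>

definition cubic_mono :: "(3 \<Rightarrow> 'a::comm_ring_1) \<Rightarrow> cubic_index \<Rightarrow> 'a" where
  "cubic_mono x I = (\<Prod>p\<in>UNIV. x p ^ expo I p)"

definition cubic_form :: "cubic \<Rightarrow> complex ^ 3 \<Rightarrow> complex" where
  "cubic_form c x = (\<Sum>I\<in>UNIV. c $ I * cubic_mono (\<lambda>p. x $ p) I)"

definition smooth_cubics :: "cubic set" where
  "smooth_cubics =
     {c. \<not> (\<exists>x. x \<noteq> 0 \<and> cubic_form c x = 0 \<and> (\<forall>p. cpartial p (cubic_form c) x = 0))}"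

text \<open>The polynomials \<open>P\<close> in the ten variables indexed by \<open>I\<close> with \<open>P((x\<^sup>I)\<^sub>I) = 0\<close>
  in the polynomial ring in \<open>x\<^sub>1, x\<^sub>2, x\<^sub>3\<close>.\<close>

definition poly_var :: "'v \<Rightarrow> 'v cpoly" where
  "poly_var v = Poly_Mapping.single (Poly_Mapping.single v 1) 1"

definition veronese_ideal :: "cubic_index cpoly set" where
  "veronese_ideal =
     {P. poly_subst (Poly_Mapping.single 0) (cubic_mono poly_var :: cubic_index \<Rightarrow> 3 cpoly) P = 0}"

text \<open>The infinitesimal action of a matrix \<open>Z\<close> on cubic forms induced by
  \<open>(g \<cdot> f)(x) = f(g\<^sup>-\<^sup>1 x)\<close>, that is \<open>f \<mapsto> - \<Sum>\<^sub>p\<^sub>,\<^sub>q Z\<^sub>p\<^sub>q x\<^sub>q \<partial>f/\<partial>x\<^sub>p\<close>: the condition below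
  says that \<open>x\<^sup>J\<close> is the monomial of \<open>x\<^sub>q \<partial>x\<^sup>I/\<partial>x\<^sub>p\<close>.\<close>

definition lie_action :: "complex ^ 3 ^ 3 \<Rightarrow> cubic \<Rightarrow> cubic" where
  "lie_action Z c =
     (\<chi> J. - (\<Sum>I\<in>UNIV. \<Sum>p\<in>UNIV. \<Sum>q\<in>UNIV.
        if \<forall>r. expo J r + of_bool (r = p) = expo I r + of_bool (r = q)
        then Z $ p $ q * of_nat (expo I p) * c $ I else 0))"

lemma cubic_mono_shift:
  fixes x :: "3 \<Rightarrow> complex"
  shows "of_nat (expo I p) *
      (\<Sum>J\<in>UNIV. if \<forall>r. expo J r + of_bool (r = p) = expo I r + of_bool (r = q)
         then cubic_mono x J else 0) =
    of_nat (expo I p) * (x q * x p ^ (expo I p - 1) * (\<Prod>r\<in>UNIV - {p}. x r ^ expo I r))"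
proof (cases "expo I p = 0")
  case False
  define K where "K = (\<lambda>r. expo I r + of_bool (r = q) - of_bool (r = p))"
  have K: "K r + of_bool (r = p) = expo I r + of_bool (r = q)" for r
    using False by (auto simp: K_def)
  have "(\<Sum>r\<in>UNIV. K r) + (\<Sum>r\<in>UNIV. of_bool (r = p)) =
      (\<Sum>r\<in>UNIV. expo I r) + (\<Sum>r\<in>UNIV. of_bool (r = q))"
    unfolding sum.distrib[symmetric] by (simp only: K)
  then have "(\<Sum>r\<in>UNIV. K r) = 3"
    using expo[of I] by (simp add: of_bool_def)
  then obtain J where J: "expo J = K"
    using Abs_cubic_index_inverse[of K] by blast
  have eq: "(\<forall>r. expo J' r + of_bool (r = p) = expo I r + of_bool (r = q)) \<longleftrightarrow> J' = J" for J'
  proof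
    assume "\<forall>r. expo J' r + of_bool (r = p) = expo I r + of_bool (r = q)"
    then have "expo J' = expo J"
      unfolding J using K by (metis add_right_cancel ext)
    then show "J' = J" by (simp add: expo_inject)
  qed (use J K in simp)
  have "cubic_mono x J = (\<Prod>r\<in>UNIV. x r ^ of_bool (r = q) * x r ^ (expo I r - of_bool (r = p)))"
    unfolding cubic_mono_def J power_add[symmetric] K_def
    by (intro prod.cong refl arg_cong2[where f = "(^)"]) (use False in auto)
  also have "\<dots> = x q * (\<Prod>r\<in>UNIV. x r ^ (expo I r - of_bool (r = p)))"
    unfolding prod.distrib by (simp add: of_bool_def if_distrib prod.delta cong: if_cong)
  also have "(\<Prod>r\<in>UNIV. x r ^ (expo I r - of_bool (r = p))) =
      x p ^ (expo I p - 1) * (\<Prod>r\<in>UNIV - {p}. x r ^ (expo I r - of_bool (r = p)))"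
    by (subst prod.remove[of _ p]) auto
  also have "(\<Prod>r\<in>UNIV - {p}. x r ^ (expo I r - of_bool (r = p))) =
      (\<Prod>r\<in>UNIV - {p}. x r ^ expo I r)"
    by (intro prod.cong) auto
  finally show ?thesis
    by (simp add: eq mult.assoc)
qed simp

text \<open>The first-order part of \<open>f((1 - t Z) x)\<close> is the form \<open>lie_action Z c\<close>.\<close>

lemma lie_action_deriv:
  "((\<lambda>t. cubic_form c (x - t *s (Z *v x))) has_field_derivative
     cubic_form (lie_action Z c) x) (at 0)"
proof -
  define y where "y = Z *v x"
  define D where "D I p = of_nat (expo I p) *
    (x $ p ^ (expo I p - 1) * (\<Prod>r\<in>UNIV - {p}. x $ r ^ expo I r))" for I p
  have "((\<lambda>t. cubic_mono (\<lambda>p. (x - t *s y) $ p) I) has_field_derivative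
      - (\<Sum>p\<in>UNIV. y $ p * D I p)) (at 0)" for I
    unfolding cubic_mono_def D_def UNIV_3
    by (auto intro!: derivative_eq_intros simp: insert_Diff_if algebra_simps)
  then have "((\<lambda>t. cubic_form c (x - t *s y)) has_field_derivative
      (\<Sum>I\<in>UNIV. c $ I * - (\<Sum>p\<in>UNIV. y $ p * D I p))) (at 0)"
    unfolding cubic_form_def by (intro DERIV_sum DERIV_cmult)
  also have "(\<Sum>I\<in>UNIV. c $ I * - (\<Sum>p\<in>UNIV. y $ p * D I p)) =
      - (\<Sum>I\<in>UNIV. \<Sum>p\<in>UNIV. \<Sum>q\<in>UNIV. Z $ p $ q * c $ I * (x $ q * D I p))"
    by (simp add: y_def matrix_vector_mult_def sum_distrib_left sum_distrib_right sum_negf mult_ac)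
  also have "\<dots> = - (\<Sum>I\<in>UNIV. \<Sum>p\<in>UNIV. \<Sum>q\<in>UNIV. Z $ p $ q * c $ I * (of_nat (expo I p) *
      (\<Sum>J\<in>UNIV. if \<forall>r. expo J r + of_bool (r = p) = expo I r + of_bool (r = q)
         then cubic_mono (\<lambda>p. x $ p) J else 0)))"
    unfolding cubic_mono_shift D_def by (simp add: mult_ac)
  also have "\<dots> = - (\<Sum>I\<in>UNIV. \<Sum>p\<in>UNIV. \<Sum>q\<in>UNIV. \<Sum>J\<in>UNIV.
      (if \<forall>r. expo J r + of_bool (r = p) = expo I r + of_bool (r = q)
       then Z $ p $ q * of_nat (expo I p) * c $ I else 0) * cubic_mono (\<lambda>p. x $ p) J)"
    unfolding sum_distrib_left
    by (intro arg_cong[where f = uminus] sum.cong refl) auto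
  also have "\<dots> = cubic_form (lie_action Z c) x"
    unfolding cubic_form_def lie_action_def vec_lambda_beta mult_minus_left sum_negf
      sum_distrib_right
    by (subst (2) sum.swap, subst (3) sum.swap, subst (4) sum.swap) (rule refl)
  finally show ?thesis
    unfolding y_def .
qed

text \<open>Sections over \<open>W\<close> of the solution sheaf of the tautological system.\<close>

definition tautological_solution :: "cubic set \<Rightarrow> (cubic \<Rightarrow> complex) \<Rightarrow> bool" where
  "tautological_solution W s \<longleftrightarrow>
     open W \<and> holomorphic_vec_on s W \<and>
     (\<forall>P\<in>veronese_ideal. \<forall>c\<in>W. poly_op P s c = 0) \<and>
     (\<forall>Z. trace Z = 0 \<longrightarrow> (\<forall>c\<in>W. (\<Sum>I\<in>UNIV. lie_action Z c $ I * cpartial I s c) = 0)) \<and>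
     (\<forall>c\<in>W. (\<Sum>I\<in>UNIV. c $ I * cpartial I s c) + s c = 0)"

text \<open>An element of the stalk at \<open>b\<close> is represented by a section over an open neighbourhood
  of \<open>b\<close>.\<close>

definition null_locus :: "((cubic \<Rightarrow> complex) \<Rightarrow> cubic \<Rightarrow> complex) \<Rightarrow> cubic set" where
  "null_locus \<delta> =
     {b \<in> smooth_cubics. \<forall>W s. b \<in> W \<and> tautological_solution W s \<longrightarrow> \<delta> s b = 0}"

text \<open>The operator \<open>\<Sum>\<^sub>I l\<^sub>I \<partial>/\<partial>a\<^sub>I\<close> for the coordinates \<open>a\<^sub>I = \<kappa>\<^sub>I c\<^sub>I\<close>, so that
  \<open>\<partial>/\<partial>a\<^sub>I = \<kappa>\<^sub>I\<^sup>-\<^sup>1 \<partial>/\<partial>c\<^sub>I\<close>.\<close>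

definition first_order_op ::
    "complex ^ cubic_index \<Rightarrow> complex ^ cubic_index \<Rightarrow> (cubic \<Rightarrow> complex) \<Rightarrow> cubic \<Rightarrow> complex" where
  "first_order_op \<kappa> l s c = (\<Sum>I\<in>UNIV. l $ I * (inverse (\<kappa> $ I) * cpartial I s c))"

end

theory Submission
  imports Defs
begin

text \<open>Solutions are annihilated by the vector fields of \<open>sl\<^sub>3\<close>, so \<open>b\<close> lies in the null locus of
  \<open>\<delta>\<close> as soon as \<open>b\<close> is smooth and \<open>\<delta>\<close>, viewed as a vector, equals \<open>Z \<cdot> b\<close> for some traceless \<open>Z\<close>.
  Take \<open>Z = -(diag(1,2,-3) + u E\<^sub>1\<^sub>2)\<close>. On cubics it is triangular, and its only vanishing
  eigenvalue is the one of \<open>x\<^sub>1 x\<^sub>2 x\<^sub>3\<close>; choosing \<open>u\<close> such that the equation for that monomial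
  holds, one solves \<open>Z \<cdot> b = \<delta>\<close> for \<open>b\<close> with coordinates that are polynomial in \<open>\<delta>\<close> up to
  powers of the coordinate of \<open>x\<^sub>1\<^sup>2 x\<^sub>3\<close> in the denominator. Smoothness of \<open>b\<close> is a consequence of
  the nonvanishing of a maximal minor of the Macaulay matrix, which expresses multiples of the partial
  derivatives of the form in terms of the quartic monomials and is three times the identity at the
  Fermat cubic.\<close>

section \<open>Polynomial functions and their localisations\<close>

definition polyfun :: "(complex ^ 'v::finite \<Rightarrow> complex) \<Rightarrow> bool" where
  "polyfun f \<longleftrightarrow> (\<exists>P. \<forall>a. f a = poly_subst (\<lambda>c. c) (\<lambda>v. a $ v) P)"

lemma poly_subst_superset:
  assumes "finite A" "Poly_Mapping.keys P \<subseteq> A"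
  shows "poly_subst (\<lambda>c. c) f P =
    (\<Sum>m\<in>A. Poly_Mapping.lookup P m * (\<Prod>v\<in>UNIV. f v ^ Poly_Mapping.lookup m v))"
  unfolding poly_subst_def
  by (rule sum.mono_neutral_left) (use assms in \<open>auto simp: in_keys_iff\<close>)

lemma polyfun_monomial: "polyfun (\<lambda>a. c * (\<Prod>v\<in>UNIV. a $ v ^ Poly_Mapping.lookup m v))"
  unfolding polyfun_def
proof (intro exI allI)
  fix a :: "complex ^ 'a"
  show "c * (\<Prod>v\<in>UNIV. a $ v ^ Poly_Mapping.lookup m v) =
      poly_subst (\<lambda>c. c) (\<lambda>v. a $ v) (Poly_Mapping.single m c)"
    by (subst poly_subst_superset[of "{m}"]) auto
qed

lemma polyfun_const: "polyfun (\<lambda>a. c)"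
  using polyfun_monomial[of c 0] by simp

lemma polyfun_coord: "polyfun (\<lambda>a. a $ v)"
proof -
  have "(\<Prod>w\<in>UNIV. a $ w ^ Poly_Mapping.lookup (Poly_Mapping.single v 1) w) = a $ v"
    for a :: "complex ^ 'a"
    by (subst prod.remove[of _ v]) (auto simp: lookup_single intro!: prod.neutral)
  then show ?thesis
    using polyfun_monomial[of 1 "Poly_Mapping.single v 1"] by simp
qed

lemma polyfun_add:
  assumes "polyfun f" "polyfun g"
  shows "polyfun (\<lambda>a. f a + g a)"
proof -
  obtain P R where P: "\<And>a. f a = poly_subst (\<lambda>c. c) (\<lambda>v. a $ v) P"
    and R: "\<And>a. g a = poly_subst (\<lambda>c. c) (\<lambda>v. a $ v) R"
    using assms unfolding polyfun_def by blast
  define A where "A = Poly_Mapping.keys P \<union> Poly_Mapping.keys R"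
  have "finite A" by (simp add: A_def)
  have "f a + g a = poly_subst (\<lambda>c. c) (\<lambda>v. a $ v) (P + R)" for a
  proof -
    have "Poly_Mapping.keys (P + R) \<subseteq> A"
      unfolding A_def by (rule Poly_Mapping.keys_add)
    then show ?thesis
      unfolding P R using \<open>finite A\<close>
      by (simp add: poly_subst_superset[of A] A_def lookup_add sum.distrib distrib_right)
  qed
  then show ?thesis
    unfolding polyfun_def by blast
qed

lemma polyfun_sum: "(\<And>i. i \<in> A \<Longrightarrow> polyfun (f i)) \<Longrightarrow> polyfun (\<lambda>a. \<Sum>i\<in>A. f i a)"
  by (induction A rule: infinite_finite_induct) (auto intro: polyfun_const polyfun_add)

lemma polyfun_mult:
  assumes "polyfun f" "polyfun g"
  shows "polyfun (\<lambda>a. f a * g a)"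
proof -
  obtain P R where P: "\<And>a. f a = poly_subst (\<lambda>c. c) (\<lambda>v. a $ v) P"
    and R: "\<And>a. g a = poly_subst (\<lambda>c. c) (\<lambda>v. a $ v) R"
    using assms unfolding polyfun_def by blast
  have "f a * g a = (\<Sum>m\<in>Poly_Mapping.keys P. \<Sum>n\<in>Poly_Mapping.keys R.
      (Poly_Mapping.lookup P m * Poly_Mapping.lookup R n) *
      (\<Prod>v\<in>UNIV. a $ v ^ Poly_Mapping.lookup (m + n) v))" for a
    unfolding P R poly_subst_def sum_product
    by (intro sum.cong refl) (simp add: lookup_add power_add prod.distrib mult_ac)
  then show ?thesis
    by (simp only:) (intro polyfun_sum polyfun_monomial)
qed

lemma polyfun_power: "polyfun f \<Longrightarrow> polyfun (\<lambda>a. f a ^ n)"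
  by (induction n) (auto intro: polyfun_const polyfun_mult)

text \<open>Absorbs the constants \<open>\<kappa>\<close>: the construction works with coefficients
  relative to the c_I, the open set with those relative to the a_I.\<close>

lemma polyfun_rescale:
  assumes "polyfun f"
  shows "polyfun (\<lambda>a. f (\<chi> v. k v * a $ v))"
proof -
  obtain P where P: "\<And>a. f a = poly_subst (\<lambda>c. c) (\<lambda>v. a $ v) P"
    using assms unfolding polyfun_def by blast
  have "f (\<chi> v. k v * a $ v) = (\<Sum>m\<in>Poly_Mapping.keys P.
      (Poly_Mapping.lookup P m * (\<Prod>v\<in>UNIV. k v ^ Poly_Mapping.lookup m v)) *
      (\<Prod>v\<in>UNIV. a $ v ^ Poly_Mapping.lookup m v))" for a
    unfolding P poly_subst_def by (simp add: power_mult_distrib prod.distrib mult_ac)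
  then show ?thesis
    by (simp only:) (intro polyfun_sum polyfun_monomial)
qed

lemma zariski_open_polyfun: "polyfun f \<Longrightarrow> zariski_open {a. f a \<noteq> 0}"
proof -
  assume "polyfun f"
  then obtain P where "\<And>a. f a = poly_subst (\<lambda>c. c) (\<lambda>v. a $ v) P"
    unfolding polyfun_def by blast
  then show ?thesis
    unfolding zariski_open_def by (intro exI[of _ "{P}"]) simp
qed

text \<open>Represents the localisation of the polynomial functions at q. Values on the zero set of
  q are left free, since \<open>inverse\<close> takes a default value there.\<close>

definition locpoly ::
    "(complex ^ 'v::finite \<Rightarrow> complex) \<Rightarrow> (complex ^ 'v \<Rightarrow> complex) \<Rightarrow> bool" where
  "locpoly q f \<longleftrightarrow> (\<exists>k F. polyfun F \<and> (\<forall>a. q a \<noteq> 0 \<longrightarrow> q a ^ k * f a = F a))"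

context
  fixes q :: "complex ^ 'v::finite \<Rightarrow> complex"
  assumes q: "polyfun q"
begin

lemma locpoly_polyfun: "polyfun f \<Longrightarrow> locpoly q f"
  unfolding locpoly_def by (intro exI[of _ 0] exI[of _ f]) simp

lemma locpoly_inverse: "locpoly q (\<lambda>a. inverse (q a))"
  unfolding locpoly_def by (intro exI[of _ 1] exI[of _ "\<lambda>_. 1"]) (simp add: polyfun_const)

lemma locpoly_add:
  assumes "locpoly q f" "locpoly q g"
  shows "locpoly q (\<lambda>a. f a + g a)"
proof -
  obtain k F l G where "polyfun F" "polyfun G"
    and FG: "\<And>a. q a \<noteq> 0 \<Longrightarrow> q a ^ k * f a = F a" "\<And>a. q a \<noteq> 0 \<Longrightarrow> q a ^ l * g a = G a"
    using assms unfolding locpoly_def by blast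
  then have "polyfun (\<lambda>a. q a ^ l * F a + q a ^ k * G a)"
    by (intro polyfun_add polyfun_mult polyfun_power q)
  moreover have "q a ^ (k + l) * (f a + g a) = q a ^ l * F a + q a ^ k * G a" if "q a \<noteq> 0" for a
    unfolding FG[OF that, symmetric] by (simp add: power_add algebra_simps)
  ultimately show ?thesis
    unfolding locpoly_def by blast
qed

lemma locpoly_mult:
  assumes "locpoly q f" "locpoly q g"
  shows "locpoly q (\<lambda>a. f a * g a)"
proof -
  obtain k F l G where "polyfun F" "polyfun G"
    and FG: "\<And>a. q a \<noteq> 0 \<Longrightarrow> q a ^ k * f a = F a" "\<And>a. q a \<noteq> 0 \<Longrightarrow> q a ^ l * g a = G a"
    using assms unfolding locpoly_def by blast
  then have "polyfun (\<lambda>a. F a * G a)"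
    by (intro polyfun_mult)
  moreover have "q a ^ (k + l) * (f a * g a) = F a * G a" if "q a \<noteq> 0" for a
    unfolding FG[OF that, symmetric] by (simp add: power_add algebra_simps)
  ultimately show ?thesis
    unfolding locpoly_def by blast
qed

lemma locpoly_const: "locpoly q (\<lambda>a. c)"
  by (rule locpoly_polyfun[OF polyfun_const])

lemma locpoly_coord: "locpoly q (\<lambda>a. a $ v)"
  by (rule locpoly_polyfun[OF polyfun_coord])

lemma locpoly_sum: "(\<And>i. i \<in> A \<Longrightarrow> locpoly q (f i)) \<Longrightarrow> locpoly q (\<lambda>a. \<Sum>i\<in>A. f i a)"
  by (induction A rule: infinite_finite_induct) (auto intro: locpoly_const locpoly_add)

lemma locpoly_prod: "(\<And>i. i \<in> A \<Longrightarrow> locpoly q (f i)) \<Longrightarrow> locpoly q (\<lambda>a. \<Prod>i\<in>A. f i a)"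
  by (induction A rule: infinite_finite_induct) (auto intro: locpoly_const locpoly_mult)

lemma locpoly_diff:
  assumes "locpoly q f" "locpoly q g"
  shows "locpoly q (\<lambda>a. f a - g a)"
  using locpoly_add[OF assms(1) locpoly_mult[OF locpoly_const[of "-1"] assms(2)]] by simp

lemma locpoly_det:
  fixes M :: "complex ^ 'v \<Rightarrow> complex ^ 'n::finite ^ 'n"
  assumes "\<And>i j. locpoly q (\<lambda>a. M a $ i $ j)"
  shows "locpoly q (\<lambda>a. det (M a))"
  unfolding det_def by (intro locpoly_sum locpoly_mult locpoly_const locpoly_prod assms)

end

section \<open>A polynomial criterion for smoothness\<close>

typedef quartic_index = "{I :: 3 \<Rightarrow> nat. (\<Sum>p\<in>UNIV. I p) = 4}"
  morphisms qexpo Abs_quartic_index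
proof
  show "(\<lambda>p. if p = 1 then 4 else 0) \<in> {I :: 3 \<Rightarrow> nat. (\<Sum>p\<in>UNIV. I p) = 4}" by simp
qed

instance quartic_index :: finite
proof
  have "qexpo I p \<le> 4" for I :: quartic_index and p
    using qexpo[of I] member_le_sum[of p UNIV "qexpo I"] by simp
  then have "range qexpo \<subseteq> PiE (UNIV :: 3 set) (\<lambda>_. {..4})"
    by auto
  moreover have "finite (PiE (UNIV :: 3 set) (\<lambda>_. {..4::nat}))"
    by (intro finite_PiE) auto
  ultimately have "finite (range qexpo)"
    by (rule finite_subset)
  then show "finite (UNIV :: quartic_index set)"
    by (rule finite_imageD) (simp add: inj_on_def qexpo_inject)
qed

definition quartic_mono :: "complex ^ 3 \<Rightarrow> quartic_index \<Rightarrow> complex" where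
  "quartic_mono x m = (\<Prod>p\<in>UNIV. x $ p ^ qexpo m p)"

text \<open>Choosing one variable per quartic monomial keeps as many rows of the Macaulay matrix as
  columns, so that its determinant makes sense.\<close>

definition square_var :: "quartic_index \<Rightarrow> 3" where
  "square_var m = (SOME p. 2 \<le> qexpo m p)"

lemma square_var: "2 \<le> qexpo m (square_var m)"
proof -
  have "\<exists>p. 2 \<le> qexpo m p"
  proof (rule ccontr)
    assume "\<nexists>p. 2 \<le> qexpo m p"
    then have "qexpo m p \<le> 1" for p
      by (metis Suc_1 not_less_eq_eq)
    then have "(\<Sum>p\<in>UNIV. qexpo m p) \<le> (\<Sum>p\<in>(UNIV :: 3 set). 1)"
      by (intro sum_mono)
    then show False
      using qexpo[of m] by simp
  qed
  then show ?thesis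
    unfolding square_var_def by (rule someI_ex)
qed

text \<open>Row \<open>m\<close> lists the coefficients of the quartic form \<open>(x\<^sup>m / x\<^sub>p\<^sup>2) \<partial>f/\<partial>x\<^sub>p\<close> with
  \<open>p = square_var m\<close>.\<close>

definition macaulay :: "cubic \<Rightarrow> complex ^ quartic_index ^ quartic_index" where
  "macaulay c = (\<chi> m n. \<Sum>I\<in>UNIV.
     if \<forall>r. qexpo n r + 3 * of_bool (r = square_var m) = qexpo m r + expo I r
     then c $ I * of_nat (expo I (square_var m)) else 0)"

lemma cpartial_cubic_form:
  "cpartial p (cubic_form c) x =
    (\<Sum>I\<in>UNIV. c $ I * (of_nat (expo I p) *
      (x $ p ^ (expo I p - 1) * (\<Prod>r\<in>UNIV - {p}. x $ r ^ expo I r))))"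
proof -
  have "((\<lambda>t. cubic_mono (\<lambda>r. (x + t *s axis p 1) $ r) I) has_field_derivative
      of_nat (expo I p) * (x $ p ^ (expo I p - 1) * (\<Prod>r\<in>UNIV - {p}. x $ r ^ expo I r))) (at 0)"
    for I
  proof -
    have eq: "cubic_mono (\<lambda>r. (x + t *s axis p 1) $ r) I =
        (x $ p + t) ^ expo I p * (\<Prod>r\<in>UNIV - {p}. x $ r ^ expo I r)" for t
      unfolding cubic_mono_def
      by (subst prod.remove[of _ p]) (auto simp: axis_def intro!: prod.cong)
    show ?thesis
      unfolding eq by (auto intro!: derivative_eq_intros)
  qed
  then have "((\<lambda>t. cubic_form c (x + t *s axis p 1)) has_field_derivative
      (\<Sum>I\<in>UNIV. c $ I * (of_nat (expo I p) *
      (x $ p ^ (expo I p - 1) * (\<Prod>r\<in>UNIV - {p}. x $ r ^ expo I r))))) (at 0)"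
    unfolding cubic_form_def by (intro DERIV_sum DERIV_cmult)
  then show ?thesis
    unfolding cpartial_def by (rule DERIV_imp_deriv)
qed

text \<open>If x_p does not divide x^I, both sides vanish. Otherwise exactly one n satisfies the
  condition, the exponent of x^m x^I / x_p^3.\<close>

lemma quartic_mono_shift:
  assumes p: "p = square_var m"
  shows "(\<Sum>n\<in>UNIV. (if \<forall>r. qexpo n r + 3 * of_bool (r = p) = qexpo m r + expo I r
      then c * of_nat (expo I p) else 0) * quartic_mono x n) =
    x $ p ^ (qexpo m p - 2) * (\<Prod>r\<in>UNIV - {p}. x $ r ^ qexpo m r) *
      (c * (of_nat (expo I p) * (x $ p ^ (expo I p - 1) * (\<Prod>r\<in>UNIV - {p}. x $ r ^ expo I r))))"
proof (cases "expo I p = 0")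
  case False
  have m2: "2 \<le> qexpo m p"
    unfolding p by (rule square_var)
  \<comment> \<open>The subtraction on naturals is exact: x_p occurs at least twice in x^m and at
    least once in x^I.\<close>
  define K where "K = (\<lambda>r. qexpo m r + expo I r - 3 * of_bool (r = p))"
  have K: "K r + 3 * of_bool (r = p) = qexpo m r + expo I r" for r
    using False m2 by (auto simp: K_def)
  have "(\<Sum>r\<in>UNIV. K r) + (\<Sum>r\<in>UNIV. 3 * of_bool (r = p)) =
      (\<Sum>r\<in>UNIV. qexpo m r) + (\<Sum>r\<in>UNIV. expo I r)"
    unfolding sum.distrib[symmetric] by (simp only: K)
  moreover have "(\<Sum>r\<in>UNIV. 3 * of_bool (r = p)) = (3::nat)"
    by (simp add: of_bool_def if_distrib cong: if_cong)
  ultimately have "(\<Sum>r\<in>UNIV. K r) = 4"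
    using expo[of I] qexpo[of m] by simp
  then obtain J where J: "qexpo J = K"
    using Abs_quartic_index_inverse[of K] by blast
  have eq: "(\<forall>r. qexpo n r + 3 * of_bool (r = p) = qexpo m r + expo I r) \<longleftrightarrow> n = J" for n
  proof
    assume "\<forall>r. qexpo n r + 3 * of_bool (r = p) = qexpo m r + expo I r"
    then have "qexpo n = qexpo J"
      unfolding J using K by (metis add_right_cancel ext)
    then show "n = J" by (simp add: qexpo_inject)
  qed (use J K in simp)
  have "quartic_mono x J = x $ p ^ K p * (\<Prod>r\<in>UNIV - {p}. x $ r ^ K r)"
    unfolding quartic_mono_def J by (rule prod.remove) auto
  also have "K p = (qexpo m p - 2) + (expo I p - 1)"
    using False m2 by (simp add: K_def)
  also have "(\<Prod>r\<in>UNIV - {p}. x $ r ^ K r) =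
      (\<Prod>r\<in>UNIV - {p}. x $ r ^ qexpo m r) * (\<Prod>r\<in>UNIV - {p}. x $ r ^ expo I r)"
    unfolding prod.distrib[symmetric] by (intro prod.cong) (auto simp: K_def power_add)
  finally have "quartic_mono x J = x $ p ^ (qexpo m p - 2 + (expo I p - 1)) *
      ((\<Prod>r\<in>UNIV - {p}. x $ r ^ qexpo m r) * (\<Prod>r\<in>UNIV - {p}. x $ r ^ expo I r))" .
  moreover have "(\<Sum>n\<in>UNIV. (if n = J then c * of_nat (expo I p) else 0) * quartic_mono x n) =
      c * of_nat (expo I p) * quartic_mono x J"
    by (subst sum.remove[of _ J]) auto
  ultimately show ?thesis
    by (simp add: eq power_add mult_ac)
qed (simp cong: if_cong)

lemma macaulay_mult_quartic_mono:
  assumes p: "p = square_var m"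
  shows "(macaulay c *v (\<chi> n. quartic_mono x n)) $ m =
    x $ p ^ (qexpo m p - 2) * (\<Prod>r\<in>UNIV - {p}. x $ r ^ qexpo m r) * cpartial p (cubic_form c) x"
proof -
  have "(macaulay c *v (\<chi> n. quartic_mono x n)) $ m =
     (\<Sum>n\<in>UNIV. \<Sum>I\<in>UNIV. (if \<forall>r. qexpo n r + 3 * of_bool (r = p) = qexpo m r + expo I r
      then c $ I * of_nat (expo I p) else 0) * quartic_mono x n)"
    by (simp only: macaulay_def matrix_vector_mult_def vec_lambda_beta p sum_distrib_right)
  also have "\<dots> = (\<Sum>I\<in>UNIV. \<Sum>n\<in>UNIV. (if \<forall>r. qexpo n r + 3 * of_bool (r = p) = qexpo m r + expo I r
      then c $ I * of_nat (expo I p) else 0) * quartic_mono x n)"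
    by (rule sum.swap)
  also have "\<dots> = x $ p ^ (qexpo m p - 2) * (\<Prod>r\<in>UNIV - {p}. x $ r ^ qexpo m r) *
      cpartial p (cubic_form c) x"
    unfolding quartic_mono_shift[OF p] cpartial_cubic_form sum_distrib_left ..
  finally show ?thesis .
qed

text \<open>At a singular point the vector of quartic monomials lies in the kernel of the matrix,
  hence vanishes; its entries x_p^4 then force x = 0.\<close>

lemma smooth_if_det_macaulay:
  assumes "det (macaulay c) \<noteq> 0"
  shows "c \<in> smooth_cubics"
  unfolding smooth_cubics_def
proof safe
  fix x :: "complex ^ 3"
  assume x: "\<forall>p. cpartial p (cubic_form c) x = 0" "x \<noteq> 0"
  have "macaulay c *v (\<chi> n. quartic_mono x n) = 0"
    unfolding vec_eq_iff using macaulay_mult_quartic_mono[OF refl, of c x] x(1) by simp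
  then have "(\<chi> n. quartic_mono x n) = 0"
    using assms by (metis invertible_det_nz matrix_left_invertible_ker invertible_def)
  then have z: "quartic_mono x n = 0" for n
    by (simp add: vec_eq_iff)
  have "x $ p = 0" for p
  proof -
    have "qexpo (Abs_quartic_index (\<lambda>r. if r = p then 4 else 0)) = (\<lambda>r. if r = p then 4 else 0)"
      by (rule Abs_quartic_index_inverse) simp
    then show ?thesis
      using z[of "Abs_quartic_index (\<lambda>r. if r = p then 4 else 0)"]
      unfolding quartic_mono_def by (auto split: if_splits)
  qed
  then show False
    using x(2) by (simp add: vec_eq_iff)
qed

section \<open>Nonvanishing of the minor near the Fermat cubic\<close>

definition fermat :: cubic where
  "fermat = (\<chi> I. of_bool (\<exists>p. expo I p = 3))"

lemma ex_3: "(\<exists>p :: 3. P p) \<longleftrightarrow> P 1 \<or> P 2 \<or> P 3"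
  using forall_3[of "\<lambda>p. \<not> P p"] by blast

lemma expo_sum: "expo I 1 + expo I 2 + expo I 3 = 3"
  using expo[of I] by (simp add: sum_3)

text \<open>The partial derivative of the Fermat cubic by x_p is 3 x_p^2, and multiplying by x^m /
  x_p^2 gives 3 x^m.\<close>

lemma macaulay_fermat: "macaulay fermat = mat 3"
proof -
  have "macaulay fermat $ m $ n = (if m = n then 3 else 0)" for m n
  proof -
    define p where "p = square_var m"
    define T where "T = Abs_cubic_index (\<lambda>r. if r = p then 3 else 0)"
    have T: "expo T = (\<lambda>r. if r = p then 3 else 0)"
      unfolding T_def by (rule Abs_cubic_index_inverse) simp
    have *: "fermat $ I * of_nat (expo I p) = (if I = T then 3 else 0)" for I
    proof (cases "\<exists>r. expo I r = 3")
      case True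
      then obtain r where r: "expo I r = 3" by blast
      have "expo I = (\<lambda>r'. if r' = r then 3 else 0)"
      proof
        fix r'
        show "expo I r' = (if r' = r then 3 else 0)"
          using r expo[of I] sum.remove[of UNIV r "expo I"] by auto
      qed
      then show ?thesis
        using r T by (auto simp: fermat_def expo_inject[symmetric] fun_eq_iff)
    next
      case False
      then have "I \<noteq> T"
        using T by metis
      with False show ?thesis
        by (simp add: fermat_def)
    qed
    have "macaulay fermat $ m $ n = (\<Sum>I\<in>UNIV. if I = T then
        (if \<forall>r. qexpo n r + 3 * of_bool (r = p) = qexpo m r + expo I r then 3 else 0) else 0)"
      unfolding macaulay_def vec_lambda_beta p_def[symmetric] *
      by (intro sum.cong refl) simp
    also have "\<dots> = (if \<forall>r. qexpo n r = qexpo m r then 3 else 0)"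
      by (auto simp: T of_bool_def)
    also have "(\<forall>r. qexpo n r = qexpo m r) \<longleftrightarrow> m = n"
      by (auto simp: fun_eq_iff qexpo_inject[symmetric])
    finally show ?thesis .
  qed
  then show ?thesis
    by (simp add: vec_eq_iff mat_def)
qed

text \<open>By continuity the minor stays nonzero for small e. The perturbation is wanted because
  the Fermat cubic has no x1^2 x3 term, whose coefficient has to be inverted later.\<close>

lemma exists_det_macaulay_nonzero:
  "\<exists>e. e \<noteq> 0 \<and> det (macaulay (fermat + e *s axis I 1)) \<noteq> 0"
proof -
  have "isCont (\<lambda>e. macaulay (fermat + e *s axis I 1) $ m $ n) 0" for m n
  proof -
    have "isCont (\<lambda>e. if B then (fermat + e *s axis I 1) $ J * of_nat d else 0) 0" for B J d
      by (cases B) (auto intro!: continuous_intros)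
    then show ?thesis
      unfolding macaulay_def by simp
  qed
  then have "isCont (\<lambda>e. det (macaulay (fermat + e *s axis I 1))) 0"
    unfolding det_def by (intro continuous_sum continuous_mult continuous_const continuous_prod)
  moreover have "det (macaulay (fermat + 0 *s axis I 1)) \<noteq> 0"
    by (simp add: macaulay_fermat det_diagonal mat_def)
  ultimately have "\<forall>\<^sub>F e in at 0. det (macaulay (fermat + e *s axis I 1)) \<noteq> 0"
    by (intro tendsto_imp_eventually_ne) (auto simp: isCont_def)
  then have "\<forall>\<^sub>F e in at (0::complex). e \<noteq> 0 \<and> det (macaulay (fermat + e *s axis I 1)) \<noteq> 0"
    by (auto simp: eventually_conj_iff eventually_at_filter)
  then show ?thesis
    using eventually_happens by force
qed

section \<open>Solving for a cubic with prescribed tangent vector\<close>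

text \<open>The exponents of x2 and x3 serve as coordinates because the recursion below runs over
  the exponent of x2. Meaningful for j + k \<le> 3.\<close>

definition cub :: "nat \<Rightarrow> nat \<Rightarrow> cubic_index" where
  "cub j k = Abs_cubic_index (\<lambda>p. if p = 1 then 3 - j - k else if p = 2 then j else k)"

lemma expo_cub:
  assumes "j + k \<le> 3"
  shows "expo (cub j k) 1 = 3 - j - k" "expo (cub j k) 2 = j" "expo (cub j k) 3 = k"
proof -
  have "expo (cub j k) = (\<lambda>p. if p = 1 then 3 - j - k else if p = 2 then j else k)"
    unfolding cub_def by (rule Abs_cubic_index_inverse) (use assms in \<open>simp add: sum_3\<close>)
  then show "expo (cub j k) 1 = 3 - j - k" "expo (cub j k) 2 = j" "expo (cub j k) 3 = k"
    by simp_all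
qed

lemma cubic_index_eq_iff: "I = J \<longleftrightarrow> expo I 2 = expo J 2 \<and> expo I 3 = expo J 3"
proof
  assume "expo I 2 = expo J 2 \<and> expo I 3 = expo J 3"
  moreover from this have "expo I 1 = expo J 1"
    using expo_sum[of I] expo_sum[of J] by simp
  ultimately have "expo I = expo J"
    by (simp add: fun_eq_iff forall_3)
  then show "I = J"
    by (simp add: expo_inject)
qed simp

lemma cub_expo: "cub (expo I 2) (expo I 3) = I"
  unfolding cubic_index_eq_iff[of _ I] using expo_sum[of I] by (simp add: expo_cub)

text \<open>The eigenvalue of \<open>diag(1,2,-3)\<close> on \<open>x\<^sub>1\<^sup>i x\<^sub>2\<^sup>j x\<^sub>3\<^sup>k\<close>, \<open>i = 3 - j - k\<close>.\<close>

definition weight :: "nat \<Rightarrow> nat \<Rightarrow> complex" where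
  "weight j k = 3 + of_nat j - 4 * of_nat k"

lemma weight_nonzero:
  assumes "j + k \<le> 3" "(j, k) \<noteq> (1, 1)"
  shows "weight j k \<noteq> 0"
proof
  assume "weight j k = 0"
  then have "of_nat (3 + j) = (of_nat (4 * k) :: complex)"
    by (simp add: weight_def)
  then have "3 + j = 4 * k"
    by (simp only: of_nat_eq_iff)
  then show False
    using assms by (cases "k = 0"; cases "k = 1"; simp)
qed

text \<open>Forced by the equation at x1 x2 x3: the weight there is 0, leaving 2 u b = a with b the
  solution's coefficient of x1^2 x3, which is \<open>- a $ cub 0 1\<close> as that monomial has
  weight -1.\<close>

definition shear :: "cubic \<Rightarrow> complex" where
  "shear a = - a $ cub 1 1 * inverse (a $ cub 0 1) / 2"

text \<open>Forward substitution in the triangular system. The coefficient of x1 x2 x3 is free, its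
  weight being 0, and is set to 0.\<close>

primrec solution_coeff :: "nat \<Rightarrow> nat \<Rightarrow> cubic \<Rightarrow> complex" where
  "solution_coeff 0 k a = a $ cub 0 k * inverse (weight 0 k)"
| "solution_coeff (Suc j) k a = (if (j, k) = (0, 1) then 0 else
     (a $ cub (Suc j) k - shear a * of_nat (3 - j - k) * solution_coeff j k a) *
     inverse (weight (Suc j) k))"

definition solution :: "cubic \<Rightarrow> cubic" where
  "solution a = (\<chi> I. solution_coeff (expo I 2) (expo I 3) a)"

text \<open>The signs cancel the minus in \<open>lie_action\<close>: the action is x1 d/dx1 + 2 x2
  d/dx2 - 3 x3 d/dx3 + u x2 d/dx1.\<close>

definition sl3_elt :: "complex \<Rightarrow> complex ^ 3 ^ 3" where
  "sl3_elt u = (\<chi> p q. if p = 1 \<and> q = 1 then -1 else if p = 2 \<and> q = 2 then -2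
     else if p = 3 \<and> q = 3 then 3 else if p = 1 \<and> q = 2 then -u else 0)"

lemma trace_sl3_elt: "trace (sl3_elt u) = 0"
  by (simp add: trace_def sl3_elt_def sum_3)

lemma lie_action_sl3_elt:
  "lie_action (sl3_elt u) b $ J = weight (expo J 2) (expo J 3) * b $ J +
     (if expo J 2 = 0 then 0
      else u * of_nat (expo J 1 + 1) * b $ cub (expo J 2 - 1) (expo J 3))"
proof -
  \<comment> \<open>N is the exponent of x1 x^J / x2, the one monomial that u x2 d/dx1 maps to a
    multiple of x^J. If x2 does not divide x^J, truncation makes N = J, so that case is cut out
    explicitly below.\<close>
  define N where "N = cub (expo J 2 - 1) (expo J 3)"
  have J: "expo J 1 + expo J 2 + expo J 3 = 3" by (rule expo_sum)
  have N: "expo N 1 = 3 - (expo J 2 - 1) - expo J 3" "expo N 2 = expo J 2 - 1"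
      "expo N 3 = expo J 3"
    unfolding N_def using J by (simp_all add: expo_cub)
  define E where "E I p q \<longleftrightarrow> (\<forall>r. expo J r + of_bool (r = p) = expo I r + of_bool (r = q))"
    for I p q
  have diag: "E I p p \<longleftrightarrow> I = J" for I p
    by (auto simp: E_def fun_eq_iff expo_inject[symmetric])
  have off: "E I 1 2 \<longleftrightarrow> expo J 2 \<noteq> 0 \<and> I = N" for I
    using expo_sum[of I] J N by (auto simp: E_def forall_3 cubic_index_eq_iff)
  have row: "(\<Sum>p\<in>UNIV. \<Sum>q\<in>UNIV.
        if E I p q then sl3_elt u $ p $ q * of_nat (expo I p) * b $ I else 0) =
      - (if I = J then weight (expo J 2) (expo J 3) * b $ J else 0)
      - (if I = N then (if expo J 2 = 0 then 0 else u * of_nat (expo J 1 + 1) * b $ N) else 0)"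
    (is "?l = _") for I
  proof -
    have "?l = (if I = J then - of_nat (expo I 1) * b $ I else 0)
       + (if I = J then - 2 * of_nat (expo I 2) * b $ I else 0)
       + (if I = J then 3 * of_nat (expo I 3) * b $ I else 0)
       + (if expo J 2 \<noteq> 0 \<and> I = N then - u * of_nat (expo I 1) * b $ I else 0)"
      by (simp add: sum_3 sl3_elt_def diag off)
    also have "\<dots> = - (if I = J then
          (of_nat (expo J 1) + 2 * of_nat (expo J 2) - 3 * of_nat (expo J 3)) * b $ J else 0)
       - (if I = N then (if expo J 2 = 0 then 0 else u * of_nat (expo N 1) * b $ N) else 0)"
      by (cases "I = J"; cases "I = N"; simp add: algebra_simps)
    also have "of_nat (expo J 1) + 2 * of_nat (expo J 2) - 3 * of_nat (expo J 3) =
        weight (expo J 2) (expo J 3)"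
      using arg_cong[OF J, of "of_nat :: nat \<Rightarrow> complex"] by (simp add: weight_def algebra_simps)
    also have "(if expo J 2 = 0 then 0 else u * of_nat (expo N 1) * b $ N) =
        (if expo J 2 = 0 then 0 else u * of_nat (expo J 1 + 1) * b $ N)"
    proof (cases "expo J 2 = 0")
      case False
      then have "expo N 1 = expo J 1 + 1"
        using J N by simp
      then show ?thesis by simp
    qed simp
    finally show ?thesis .
  qed
  show ?thesis
    unfolding lie_action_def vec_lambda_beta
    unfolding E_def[symmetric] row N_def[symmetric] sum_subtractf sum_negf
    by (simp add: sum.delta)
qed

lemma lie_action_solution:
  assumes "a $ cub 0 1 \<noteq> 0"
  shows "lie_action (sl3_elt (shear a)) (solution a) = a"
proof -
  have "lie_action (sl3_elt (shear a)) (solution a) $ J = a $ J" for J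
  proof -
    define j k where "j = expo J 2" and "k = expo J 3"
    have J: "J = cub j k" and jk: "j + k \<le> 3" and i: "expo J 1 = 3 - j - k"
      using cub_expo[of J] expo_sum[of J] by (auto simp: j_def k_def)
    have sol: "solution a $ cub j' k = solution_coeff j' k a" if "j' \<le> j" for j'
      using that jk by (simp add: solution_def expo_cub)
    have *: "lie_action (sl3_elt (shear a)) (solution a) $ J = weight j k * solution_coeff j k a +
        (if j = 0 then 0 else shear a * of_nat (3 - j - k + 1) * solution_coeff (j - 1) k a)"
      using sol[of j] sol[of "j - 1"]
      unfolding lie_action_sl3_elt j_def[symmetric] k_def[symmetric] i J[symmetric] by simp
    show ?thesis
    proof (cases "(j, k) = (1, 1)")
      \<comment> \<open>The free coefficient is multiplied by weight 0, and what remains is the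
        equation that determined \<open>shear\<close>.\<close>
      case True
      then show ?thesis
        unfolding * unfolding J using assms by (simp add: weight_def shear_def)
    next
      case False
      note w = weight_nonzero[OF jk False]
      show ?thesis
      proof (cases j)
        case 0
        then show ?thesis unfolding * unfolding J using w by simp
      next
        case (Suc j')
        moreover have "3 - Suc j' - k + 1 = 3 - j' - k"
          using Suc jk by simp
        ultimately show ?thesis
          unfolding * unfolding J using w False
          by (auto simp: field_simps simp del: of_nat_diff)
      qed
    qed
  qed
  then show ?thesis
    by (simp add: vec_eq_iff)
qed

text \<open>Without an x1 x2 x3 term the shear is zero and the system diagonal. This realises a
  chosen cubic as a solution, giving a point where the minor is nonzero.\<close>

lemma solution_unsheared:
  assumes "b $ cub 1 1 = 0"
  shows "solution (\<chi> I. weight (expo I 2) (expo I 3) * b $ I) = b" (is "solution ?a = b")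
proof -
  have "?a $ cub 1 1 = 0"
    using assms by (simp del: One_nat_def)
  then have u: "shear ?a = 0"
    by (simp add: shear_def)
  have "solution_coeff j k ?a = b $ cub j k" if "j + k \<le> 3" for j k
  proof (cases "(j, k) = (1, 1)")
    case True
    then show ?thesis using assms by simp
  next
    case False
    then show ?thesis
      using weight_nonzero[OF that False] that by (cases j) (auto simp: u expo_cub)
  qed
  then have "solution ?a $ I = b $ I" for I
    using expo_sum[of I] by (simp add: solution_def cub_expo)
  then show ?thesis
    by (simp add: vec_eq_iff)
qed

section \<open>Generic smoothness of the solution\<close>

lemma locpoly_det_macaulay_solution:
  "locpoly (\<lambda>a. a $ cub 0 1) (\<lambda>a. det (macaulay (solution a)))"
proof -
  let ?q = "\<lambda>a :: cubic. a $ cub 0 1"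
  note q = polyfun_coord[of "cub 0 1"]
  note intros = locpoly_mult[OF q] locpoly_const[OF q] locpoly_coord[OF q] locpoly_inverse[OF q]
    locpoly_diff[OF q]
  \<comment> \<open>The shear contributes the only non-constant denominator; the weights are
    constants.\<close>
  have "locpoly ?q (\<lambda>a. (- 1 / 2) * a $ cub 1 1 * inverse (?q a))"
    by (intro intros)
  then have shear: "locpoly ?q shear"
    by (simp add: shear_def[abs_def])
  have "locpoly ?q (solution_coeff j k)" for j k
  proof (induction j)
    case 0
    have "locpoly ?q (\<lambda>a. a $ cub 0 k * inverse (weight 0 k))"
      by (intro intros)
    then show ?case by simp
  next
    case (Suc j)
    have "locpoly ?q (\<lambda>a. (a $ cub (Suc j) k - shear a * of_nat (3 - j - k) * solution_coeff j k a) *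
        inverse (weight (Suc j) k))"
      by (intro intros shear Suc)
    then show ?case
      using locpoly_const[OF q, of 0] by (cases "(j, k) = (0, 1)") auto
  qed
  then have sol: "locpoly ?q (\<lambda>a. solution a $ I)" for I
    by (simp add: solution_def)
  have "locpoly ?q (\<lambda>a. if B then solution a $ I * of_nat n else 0)" for B I n
    by (cases B; simp only: if_True if_False; intro intros sol)
  then show ?thesis
    unfolding macaulay_def
    by (intro locpoly_det[OF q]) (simp only: vec_lambda_beta, intro locpoly_sum[OF q])
qed

lemma exists_det_macaulay_solution_nonzero:
  "\<exists>a. a $ cub 0 1 \<noteq> 0 \<and> det (macaulay (solution a)) \<noteq> 0"
proof -
  obtain e where e: "e \<noteq> 0" "det (macaulay (fermat + e *s axis (cub 0 1) 1)) \<noteq> 0"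
    using exists_det_macaulay_nonzero by blast
  define b where "b = fermat + e *s axis (cub 0 1) 1"
  have "fermat $ cub 1 1 = 0" "fermat $ cub 0 1 = 0"
    by (simp_all add: fermat_def ex_3 expo_cub)
  moreover have "cub 1 1 \<noteq> cub 0 1"
    by (simp add: cubic_index_eq_iff expo_cub)
  ultimately have b: "b $ cub 1 1 = 0" "b $ cub 0 1 = e"
    by (simp_all add: b_def axis_def)
  define a where "a = (\<chi> I. weight (expo I 2) (expo I 3) * b $ I)"
  have "a $ cub 0 1 = - e"
    unfolding a_def vec_lambda_beta b by (simp add: expo_cub weight_def)
  moreover have "solution a = b"
    unfolding a_def by (rule solution_unsheared[OF b(1)])
  ultimately show ?thesis
    using e unfolding b_def[symmetric] by (intro exI[of _ a]) simp
qed

theorem corollary7p21: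
  fixes \<kappa> :: "complex ^ cubic_index"
  assumes "\<And>I. \<kappa> $ I \<noteq> 0"
  shows "\<exists>U0 :: (complex ^ cubic_index) set. zariski_open U0 \<and> U0 \<noteq> {} \<and>
           (\<forall>l\<in>U0. null_locus (first_order_op \<kappa> l) \<noteq> {})"
proof -
  \<comment> \<open>The coefficients of the operator with respect to the d/dc_I, that is, the
    tangent vector to be attained.\<close>
  define r :: "cubic \<Rightarrow> cubic" where "r l = (\<chi> I. inverse (\<kappa> $ I) * l $ I)" for l
  obtain k F where F: "polyfun F"
    and qF: "\<And>a. a $ cub 0 1 \<noteq> 0 \<Longrightarrow> (a $ cub 0 1) ^ k * det (macaulay (solution a)) = F a"
    using locpoly_det_macaulay_solution unfolding locpoly_def by blast
  \<comment> \<open>The first factor is included because F is tied to the minor only where that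
    coefficient is nonzero.\<close>
  define U0 where "U0 = {l. r l $ cub 0 1 * F (r l) \<noteq> 0}"
  have "zariski_open U0"
    unfolding U0_def r_def
    by (intro zariski_open_polyfun polyfun_rescale[of "\<lambda>a. a $ cub 0 1 * F a"]
        polyfun_mult polyfun_coord F)
  moreover have "U0 \<noteq> {}"
  proof -
    obtain a where a: "a $ cub 0 1 \<noteq> 0" "det (macaulay (solution a)) \<noteq> 0"
      using exists_det_macaulay_solution_nonzero by blast
    have "r (\<chi> I. \<kappa> $ I * a $ I) = a"
      using assms by (simp add: r_def vec_eq_iff)
    then have "(\<chi> I. \<kappa> $ I * a $ I) \<in> U0"
      using a qF[OF a(1), symmetric] by (simp add: U0_def)
    then show ?thesis by blast
  qed
  moreover have "solution (r l) \<in> null_locus (first_order_op \<kappa> l)" if "l \<in> U0" for l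
  proof -
    have l: "r l $ cub 0 1 \<noteq> 0" "F (r l) \<noteq> 0"
      using that by (auto simp: U0_def)
    then have "solution (r l) \<in> smooth_cubics"
      using qF[OF l(1)] by (intro smooth_if_det_macaulay) auto
    moreover have "first_order_op \<kappa> l s (solution (r l)) = 0"
      if "solution (r l) \<in> W" "tautological_solution W s" for W s
    proof -
      \<comment> \<open>The invariance equation of s at the solution; since the Lie action there
        gives \<open>r l\<close>, this sum is the operator applied to s.\<close>
      have "(\<Sum>I\<in>UNIV. lie_action (sl3_elt (shear (r l))) (solution (r l)) $ I *
          cpartial I s (solution (r l))) = 0"
        using that trace_sl3_elt unfolding tautological_solution_def by blast
      then show ?thesis
        unfolding lie_action_solution[OF l(1)] first_order_op_def by (simp add: r_def mult_ac)
    qed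
    ultimately show ?thesis
      unfolding null_locus_def by blast
  qed
  ultimately show ?thesis
    by blast
qed

end
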